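(* For Rabin's algorithm there exist an adversary $\mathcal{A}$, a round $k$, a step number $t$, and a run $\rho_t$ compatible with $\mathcal{A}$, having $t$ steps and in which round $k$ is under way, such that $$\mathbf{P}_{\mathcal{A}}[R(k)\neq R_1(k-1)\mid \pi_t=\rho_t]<0.99 .$$
   Context: Rabin's algorithm. There are $n$ processes $1,\dots,n$ sharing a variable $V=(S,B,R)$ with $S\in\{0,1\}$ (initially $0$), $B\in\{0,1,\dots,b\}$ where $b=\lceil\log_2 n\rceil+4$ (initially $0$), and $R\in\{0,\dots,99\}$ (initially uniformly random). Each process $i$ has local variables $B_i\in\{0,\dots,b\}$ (initially $1$) and $R_i\in\{0,\dots,99\}\cup\{\perp\}$ (initially $\perp$). Each process cycles through regions Try, Crit, Exit, Rem. Try: "while $V\neq(0,B_i,R_i)$ do { if ($V.R\neq R_i$) or ($V.B<B_i$) then $B_i\leftarrow$ random; $V.B\leftarrow\max(V.B,B_i)$; $R_i\leftarrow V.R$; unlock; lock }; $V\leftarrow(1,0,\text{random})$; unlock"; then Crit; Exit: "lock; $V.S\leftarrow 0$; $R_i\leftarrow\perp$; $B_i\leftarrow 0$; unlock"; then Rem; then "lock" and Try again. Everything between a lock and the next unlock is one atomic step. "$B_i\leftarrow$ random" draws a fresh lottery value, independent of everything else, with $\mathbf{P}[=l]=2^{-l}$ for $1\le l\le b-1$ and $\mathbf{P}[=b]=2^{-(b-1)}$; "random" for the $R$ field is uniform on $\{0,\dots,99\}$, independent of everything else. Model. A run of an execution is the sequence of triples $(p_t,old_t,new_t)$ saying that process $p_t$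 takes the $t$-th step and moves from region $old_t$ to region $new_t$. An adversary is a map $\mathcal{A}$ from finite runs to $\{1,\dots,n\}$ choosing the next process to step; a run is compatible with $\mathcal{A}$ if each step is chosen this way. Each adversary induces a probability measure $\mathbf{P}_{\mathcal{A}}$ on executions. A round is a maximal execution fragment containing exactly one transition Try$\to$Crit, at its end. For a quantity $X$ (e.g. a program variable), $X(k)$ denotes its value just before the last step (the Try$\to$Crit transition) of round $k$; thus $R(k)$ is the value of the shared field $V.R$ and $R_1(k-1)$ the value of process 1's local variable $R_1$ at those points. $\{\pi_t=\rho_t\}$ is the event that the run of the first $t$ steps of the execution equals $\rho_t$.
   Formalization: The number of processes is assumed to be n ≥ 2; for n = 1 the claim fails, since the run is then deterministic and the probability is exactly 0.99. *)

theory Defs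
  imports "HOL-Probability.Probability"
begin

datatype region = Try | Crit | Exit | Rem

text \<open>
  \<open>VS\<close>, \<open>VB\<close>, \<open>VR\<close> are the fields of the shared variable \<open>V = (S, B, R)\<close>; \<open>LB c i\<close>, \<open>LR c i\<close>
  are the local variables \<open>B\<^sub>i\<close>, \<open>R\<^sub>i\<close> of process \<open>i\<close>, with \<open>None\<close> for \<open>\<bottom>\<close>.
\<close>

record config =
  VS :: nat
  VB :: nat
  VR :: nat
  LB :: "nat \<Rightarrow> nat"
  LR :: "nat \<Rightarrow> nat option"
  reg :: "nat \<Rightarrow> region"

type_synonym run = "(nat \<times> region \<times> region) list"

type_synonym adversary = "run \<Rightarrow> nat"

definition adversary :: "nat \<Rightarrow> adversary \<Rightarrow> bool" where
  "adversary n A \<longleftrightarrow> (\<forall>\<rho>. A \<rho> \<in> {1..n})"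

definition compatible :: "adversary \<Rightarrow> run \<Rightarrow> bool" where
  "compatible A \<rho> \<longleftrightarrow> (\<forall>s<length \<rho>. fst (\<rho> ! s) = A (take s \<rho>))"


subsection \<open>Random draws\<close>

definition lot_max :: "nat \<Rightarrow> nat" where
  "lot_max n = nat \<lceil>log 2 (real n)\<rceil> + 4"

definition lottery_mass :: "nat \<Rightarrow> nat \<Rightarrow> real" where
  "lottery_mass b l =
     (if 1 \<le> l \<and> l \<le> b - 1 then 1 / 2 ^ l else if l = b then 1 / 2 ^ (b - 1) else 0)"

definition lottery :: "nat \<Rightarrow> nat pmf" where
  "lottery b = embed_pmf (lottery_mass b)"

lemma sum_lottery_mass:
  assumes "1 \<le> b"
  shows "(\<Sum>l\<in>{1..b}. lottery_mass b l) = 1"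
proof -
  obtain m where b: "b = Suc m"
    using assms by (cases b) auto
  have geo: "(\<Sum>l\<in>{1..m}. 1 / 2 ^ l :: real) = 1 - 1 / 2 ^ m" for m
    by (induction m) (auto simp: field_simps)
  have "(\<Sum>l\<in>{1..b}. lottery_mass b l) = (\<Sum>l\<in>{1..m}. lottery_mass b l) + lottery_mass b b"
    by (simp add: b)
  also have "(\<Sum>l\<in>{1..m}. lottery_mass b l) = (\<Sum>l\<in>{1..m}. 1 / 2 ^ l)"
    by (rule sum.cong) (auto simp: b lottery_mass_def)
  also have "lottery_mass b b = 1 / 2 ^ m"
    by (auto simp: b lottery_mass_def)
  finally show ?thesis
    unfolding geo by simp
qed

lemma pmf_lottery:
  assumes "1 \<le> b"
  shows "pmf (lottery b) l = lottery_mass b l"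
  unfolding lottery_def
proof (rule pmf_embed_pmf)
  show "0 \<le> lottery_mass b l" for l
    by (simp add: lottery_mass_def)
  have "(\<integral>\<^sup>+ l. ennreal (lottery_mass b l) \<partial>count_space UNIV)
      = (\<Sum>l\<in>{1..b}. ennreal (lottery_mass b l))"
    using assms by (intro nn_integral_count_space'[where A = "{1..b}"])
      (auto simp: lottery_mass_def)
  also have "\<dots> = ennreal (\<Sum>l\<in>{1..b}. lottery_mass b l)"
    by (rule sum_ennreal) (simp add: lottery_mass_def)
  finally show "(\<integral>\<^sup>+ l. ennreal (lottery_mass b l) \<partial>count_space UNIV) = 1"
    using sum_lottery_mass[OF assms] by simp
qed

text \<open>
  A sample point supplies a fresh pair (lottery value, value for the \<open>R\<close> field) for every step.
  Step number \<open>t\<close> (counted from \<open>0\<close>) may use the pair \<open>\<omega> (Suc t)\<close>; the second component of \<open>\<omega> 0\<close>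
  is the initial value of \<open>V.R\<close>.
\<close>

definition draws :: "nat \<Rightarrow> (nat \<Rightarrow> nat \<times> nat) measure" where
  "draws n = (\<Pi>\<^sub>M t\<in>UNIV.
     measure_pmf (pair_pmf (lottery (lot_max n)) (pmf_of_set {0..99::nat})))"


subsection \<open>The algorithm\<close>

definition init :: "nat \<Rightarrow> config" where
  "init r = \<lparr>VS = 0, VB = 0, VR = r, LB = (\<lambda>i. 1), LR = (\<lambda>i. None), reg = (\<lambda>i. Rem)\<rparr>"

text \<open>
  The locked code executed by process \<open>i\<close> from a test of the loop guard up to the next unlock:
  either the guard fails and \<open>i\<close> enters its critical region, or one loop body is executed.
\<close>

definition try_step :: "nat \<Rightarrow> nat \<times> nat \<Rightarrow> config \<Rightarrow> config" where
  "try_step i d c =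
     (if (VS c, VB c, Some (VR c)) = (0, LB c i, LR c i)
      then c\<lparr>VS := 1, VB := 0, VR := snd d, reg := (reg c)(i := Crit)\<rparr>
      else if Some (VR c) \<noteq> LR c i \<or> VB c < LB c i
      then c\<lparr>VB := max (VB c) (fst d), LB := (LB c)(i := fst d),
             LR := (LR c)(i := Some (VR c)), reg := (reg c)(i := Try)\<rparr>
      else c\<lparr>reg := (reg c)(i := Try)\<rparr>)"

text \<open>
  The lock that ends the remainder region belongs to the same atomic step as the first iteration
  of the loop. As \<open>R\<^sub>i = \<bottom>\<close> holds at that point, this step always goes from \<open>Rem\<close> to \<open>Try\<close>.
\<close>

definition step :: "nat \<Rightarrow> nat \<times> nat \<Rightarrow> config \<Rightarrow> config" where
  "step i d c = (case reg c i of
       Rem \<Rightarrow> try_step i d c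
     | Try \<Rightarrow> try_step i d c
     | Crit \<Rightarrow> c\<lparr>reg := (reg c)(i := Exit)\<rparr>
     | Exit \<Rightarrow> c\<lparr>VS := 0, LR := (LR c)(i := None), LB := (LB c)(i := 0),
                 reg := (reg c)(i := Rem)\<rparr>)"


subsection \<open>Executions\<close>

text \<open>
  An execution gives for every \<open>t\<close> the configuration reached after \<open>t\<close> steps and the run
  \<open>\<pi>\<^sub>t\<close> of these steps.
\<close>

type_synonym execution = "nat \<Rightarrow> config \<times> run"

primrec exec :: "adversary \<Rightarrow> (nat \<Rightarrow> nat \<times> nat) \<Rightarrow> execution" where
  "exec A \<omega> 0 = (init (snd (\<omega> 0)), [])"
| "exec A \<omega> (Suc t) =
     (let (c, \<rho>) = exec A \<omega> t; i = A \<rho>; c' = step i (\<omega> (Suc t)) c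
      in (c', \<rho> @ [(i, reg c i, reg c' i)]))"

definition exec_space :: "execution measure" where
  "exec_space = (\<Pi>\<^sub>M t\<in>UNIV. count_space UNIV)"

definition exec_measure :: "nat \<Rightarrow> adversary \<Rightarrow> execution measure" where
  "exec_measure n A = distr (draws n) exec_space (exec A)"

abbreviation run_of :: "execution \<Rightarrow> nat \<Rightarrow> run" where
  "run_of e t \<equiv> snd (e t)"

lemma measurable_exec: "exec A \<in> measurable (draws n) exec_space"
proof -
  have comp: "(\<lambda>\<omega>. \<omega> t) \<in> measurable (draws n) (count_space UNIV)" for t
    unfolding draws_def
    by (rule measurable_compose[OF measurable_component_singleton]) auto
  have "(\<lambda>\<omega>. exec A \<omega> t) \<in> measurable (draws n) (count_space UNIV)" for t
  proof (induction t)
    case 0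
    show ?case
      using measurable_compose[OF comp[of 0],
          of "\<lambda>d. (init (snd d), [])" "count_space UNIV"] by simp
  next
    case (Suc t)
    define F where "F = (\<lambda>d (c, \<rho>). let i = A \<rho>; c' = step i d c
      in (c', \<rho> @ [(i, reg c i, reg c' i)]))"
    have "(\<lambda>\<omega>. F (\<omega> (Suc t)) (exec A \<omega> t)) \<in> measurable (draws n) (count_space UNIV)"
    proof (rule measurable_compose_countable[where f = "\<lambda>d \<omega>. F d (exec A \<omega> t)", OF _ comp])
      show "(\<lambda>\<omega>. F d (exec A \<omega> t)) \<in> measurable (draws n) (count_space UNIV)" for d
        by (rule measurable_compose[OF Suc]) simp
    qed
    moreover have "exec A \<omega> (Suc t) = F (\<omega> (Suc t)) (exec A \<omega> t)" for \<omega>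
      by (cases "exec A \<omega> t") (simp add: F_def)
    ultimately show ?case
      by (simp only:)
  qed
  then show ?thesis
    unfolding exec_space_def by (intro measurable_PiM_single') auto
qed

lemma prob_space_exec_measure: "prob_space (exec_measure n A)"
proof -
  have "prob_space (draws n)"
    unfolding draws_def by (rule prob_space_PiM) (rule prob_space_measure_pmf)
  then show ?thesis
    unfolding exec_measure_def by (rule prob_space.prob_space_distr[OF _ measurable_exec])
qed


subsection \<open>Rounds\<close>

definition entries :: "run \<Rightarrow> nat" where
  "entries \<rho> = length (filter (\<lambda>(i, old, new). old = Try \<and> new = Crit) \<rho>)"

text \<open>Rounds are numbered from \<open>1\<close>.\<close>

definition under_way :: "nat \<Rightarrow> run \<Rightarrow> bool" where
  "under_way k \<rho> \<longleftrightarrow> k = Suc (entries \<rho>)"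

text \<open>The last step of round \<open>k\<close> leads from the configuration at \<open>t\<close> to the one at \<open>Suc t\<close>.\<close>

definition round_ends :: "execution \<Rightarrow> nat \<Rightarrow> nat \<Rightarrow> bool" where
  "round_ends e k t \<longleftrightarrow> entries (run_of e t) < k \<and> entries (run_of e (Suc t)) = k"

text \<open>
  \<open>at_round X k e\<close> is \<open>X(k)\<close>. It is \<open>None\<close> on executions in which round \<open>k\<close> does not end.
\<close>

definition at_round :: "(config \<Rightarrow> 'a) \<Rightarrow> nat \<Rightarrow> execution \<Rightarrow> 'a option" where
  "at_round X k e =
     (if \<exists>t. round_ends e k t then Some (X (fst (e (LEAST t. round_ends e k t)))) else None)"

lemma measurable_at_round:
  "at_round X k \<in> measurable exec_space (count_space UNIV)"
proof -
  have comp: "(\<lambda>e. e t) \<in> measurable exec_space (count_space UNIV)" for t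
    unfolding exec_space_def by (rule measurable_component_singleton) simp
  have ent: "(\<lambda>e. entries (run_of e t)) \<in> measurable exec_space (count_space UNIV)" for t
    by (rule measurable_compose[OF comp]) simp
  have ends: "Measurable.pred exec_space (\<lambda>e. round_ends e k t)" for t
    unfolding round_ends_def
    by (intro pred_intros_logic pred_count_space_const2 pred_count_space_const1
        measurable_compose[OF ent, of "\<lambda>m. m < k" "count_space UNIV" t]) (auto intro: ent)
  have "(\<lambda>e. Some (X (fst (e t)))) \<in> measurable exec_space (count_space UNIV)" for t
    by (rule measurable_compose[OF comp]) simp
  then have "(\<lambda>e. Some (X (fst (e (LEAST t. round_ends e k t)))))
      \<in> measurable exec_space (count_space UNIV)"
    by (rule measurable_compose_countable[where f = "\<lambda>t e. Some (X (fst (e t)))"])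
      (rule measurable_Least, use ends in \<open>simp add: pred_def\<close>)
  then show ?thesis
    unfolding at_round_def
    by (rule measurable_If) (simp_all add: ends pred_intros_countable(2) flip: pred_def)
qed

end

theory Submission
  imports Defs
begin

text \<open>
  In round 1 process 1 draws \<open>x\<close> while \<open>V.R = r\<close>, then process 2 draws \<open>y \<ge> x\<close> and wins, which
  replaces \<open>V.R\<close> by \<open>r'\<close>. Process 2 comes back, draws \<open>z\<close>, and process 1 then takes two steps.
  If \<open>r' \<noteq> r\<close> it redraws a value \<open>w\<close> and fails to enter exactly when \<open>w < z\<close>. If \<open>r' = r\<close> it
  may keep \<open>x\<close>; it fails to enter when \<open>x < z\<close>, or when \<open>x > z\<close> makes it redraw some \<open>w < z\<close>.
  For fixed \<open>y, z\<close> the event \<open>x \<le> y \<and> x < z\<close> is at least as likely as \<open>x \<le> y \<and> w < z\<close>,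
  since one of \<open>x \<le> y\<close>, \<open>x < z\<close> implies the other. The second possibility adds a positive
  probability, so seeing process 1 fail twice makes \<open>r' = r\<close> more likely than its prior \<open>0.01\<close>.
  Process 2 then ends round 2 on its next step.
\<close>

section \<open>The schedule and its first nine steps\<close>

definition sched :: adversary where
  "sched \<rho> = (if length \<rho> \<in> {0, 6, 7} then 1 else 2)"

text \<open>Only conditioning on this run carries information, since \<open>sched\<close> looks at
  nothing but the number of steps. Two failures of process 1 are recorded because a changed
  \<open>V.R\<close> makes it redraw at the first attempt, so that only the second compares
  \<open>w\<close> with \<open>z\<close>.\<close>

definition losing_run :: run where
  "losing_run = [(1, Rem, Try), (2, Rem, Try), (2, Try, Crit), (2, Crit, Exit), (2, Exit, Rem),
     (2, Rem, Try), (1, Try, Try), (1, Try, Try)]"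

lemma compatible_losing_run: "compatible sched losing_run"
  by (auto simp: compatible_def sched_def losing_run_def eval_nat_numeral less_Suc_eq)

text \<open>Step \<open>t\<close> uses the draw \<open>\<omega> (Suc t)\<close>. Process 2 wins iff
  \<open>max x y = y\<close>. It later leaves \<open>V.B = z\<close>; if then \<open>r = r'\<close>,
  the case \<open>x = z\<close> lets process 1 enter at once.\<close>

lemma run_sched_iff:
  fixes \<omega> :: "nat \<Rightarrow> nat \<times> nat"
  defines "x \<equiv> fst (\<omega> 1)" and "y \<equiv> fst (\<omega> 2)" and "z \<equiv> fst (\<omega> 6)" and "w \<equiv> fst (\<omega> 7)"
    and "r \<equiv> snd (\<omega> 0)" and "r' \<equiv> snd (\<omega> 3)"
  shows "run_of (exec sched \<omega>) 8 = losing_run \<longleftrightarrow>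
    x \<le> y \<and> (if r = r' then x < z \<or> z < x \<and> w < z else w < z)"
  unfolding x_def y_def z_def w_def r_def r'_def
  \<comment> \<open>These cases settle every comparison met while the run still agrees with
    \<open>losing_run\<close>, so simplification can execute the steps.\<close>
  by (cases "fst (\<omega> 1) \<le> fst (\<omega> 2)"; cases "snd (\<omega> 0) = snd (\<omega> 3)";
      cases "fst (\<omega> 1)" "fst (\<omega> 6)" rule: linorder_cases; cases "fst (\<omega> 7) < fst (\<omega> 6)")
    (simp_all add: eval_nat_numeral sched_def losing_run_def init_def step_def try_step_def Let_def
      max_def)

text \<open>Configurations 2 and 8 are those just before rounds 1 and 2 end. Process 1 has failed
  with values below \<open>z\<close>, so \<open>V.B\<close> is still \<open>z\<close>, the local
  value of process 2, which therefore enters in step 8.\<close>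

lemma configs_sched:
  fixes \<omega> :: "nat \<Rightarrow> nat \<times> nat"
  assumes "run_of (exec sched \<omega>) 8 = losing_run"
  shows "LR (fst (exec sched \<omega> 2)) 1 = Some (snd (\<omega> 0))"
    and "VR (fst (exec sched \<omega> 8)) = snd (\<omega> 3)"
    and "run_of (exec sched \<omega>) 9 = losing_run @ [(2, Try, Crit)]"
proof -
  have xy: "fst (\<omega> 1) \<le> fst (\<omega> 2)"
    using assms by (simp only: run_sched_iff)
  consider "snd (\<omega> 0) = snd (\<omega> 3)" "fst (\<omega> 1) < fst (\<omega> 6)"
    | "snd (\<omega> 0) = snd (\<omega> 3)" "fst (\<omega> 6) < fst (\<omega> 1)" "fst (\<omega> 7) < fst (\<omega> 6)"
    | "snd (\<omega> 0) \<noteq> snd (\<omega> 3)" "fst (\<omega> 7) < fst (\<omega> 6)"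
    using assms unfolding run_sched_iff by (auto split: if_splits)
  then have "VR (fst (exec sched \<omega> 8)) = snd (\<omega> 3) \<and>
      run_of (exec sched \<omega>) 9 = losing_run @ [(2, Try, Crit)]"
    by cases (use xy in \<open>simp_all add: eval_nat_numeral sched_def losing_run_def init_def step_def
      try_step_def Let_def max_def\<close>)
  then show "VR (fst (exec sched \<omega> 8)) = snd (\<omega> 3)"
    and "run_of (exec sched \<omega>) 9 = losing_run @ [(2, Try, Crit)]"
    by blast+
  show "LR (fst (exec sched \<omega> 2)) 1 = Some (snd (\<omega> 0))"
    by (simp add: eval_nat_numeral sched_def init_def step_def try_step_def Let_def)
qed

section \<open>Locating the ends of the two rounds\<close>

lemma length_run_of_exec: "length (run_of (exec A \<omega>) t) = t"
  by (induction t) (auto simp: Let_def split: prod.splits)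

lemma run_of_exec_prefix:
  "s \<le> t \<Longrightarrow> run_of (exec A \<omega>) s = take s (run_of (exec A \<omega>) t)"
proof (induction t)
  case (Suc t)
  then show ?case
    using length_run_of_exec[of A \<omega> t] length_run_of_exec[of A \<omega> "Suc t"]
    by (cases "s = Suc t") (auto simp: Let_def split: prod.splits)
qed simp

text \<open>Replaces the least index in \<open>at_round\<close> by a known one: if the round ends
  with step \<open>s\<close>, then \<open>Suc s\<close> already has \<open>k\<close> entries and
  hence lies beyond \<open>t\<close>.\<close>

lemma at_round_eqI:
  assumes "entries (run_of e (Suc t)) = k" "\<And>s. s \<le> t \<Longrightarrow> entries (run_of e s) < k"
  shows "at_round X k e = Some (X (fst (e t)))"
proof -
  have ends: "round_ends e k t"
    using assms by (simp add: round_ends_def)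
  have "(LEAST s. round_ends e k s) = t"
  proof (rule Least_equality)
    show "round_ends e k t" by (rule ends)
    fix s assume "round_ends e k s"
    then have "entries (run_of e (Suc s)) = k"
      by (simp add: round_ends_def)
    then show "t \<le> s"
      using assms(2)[of "Suc s"] by force
  qed
  then show ?thesis
    using ends by (auto simp: at_round_def)
qed

text \<open>On the conditioning event both rounds end and \<open>R\<^sub>1\<close> is not
  \<open>\<bottom>\<close>, which accounts for the two layers of \<open>Some\<close>. Comparing the
  program variables thus means comparing the draws \<open>r'\<close> and \<open>r\<close>.\<close>

lemma at_round_sched:
  fixes \<omega> :: "nat \<Rightarrow> nat \<times> nat"
  assumes "run_of (exec sched \<omega>) 8 = losing_run"
  shows "at_round (\<lambda>c. Some (VR c)) 2 (exec sched \<omega>) = Some (Some (snd (\<omega> 3)))"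
    and "at_round (\<lambda>c. LR c 1) 1 (exec sched \<omega>) = Some (Some (snd (\<omega> 0)))"
proof -
  have run: "run_of (exec sched \<omega>) s = take s losing_run" if "s \<le> 8" for s
    using run_of_exec_prefix[OF that] assms by simp
  have "at_round (\<lambda>c. Some (VR c)) 2 (exec sched \<omega>) = Some (Some (VR (fst (exec sched \<omega> 8))))"
  proof (rule at_round_eqI)
    show "entries (run_of (exec sched \<omega>) (Suc 8)) = 2"
      using configs_sched(3)[OF assms] by (simp add: entries_def losing_run_def del: exec.simps)
    fix s :: nat assume s: "s \<le> 8"
    then have "s \<in> {0, 1, 2, 3, 4, 5, 6, 7, 8}" by auto
    then show "entries (run_of (exec sched \<omega>) s) < 2"
      unfolding run[OF s] by (auto simp: entries_def losing_run_def)
  qed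
  then show "at_round (\<lambda>c. Some (VR c)) 2 (exec sched \<omega>) = Some (Some (snd (\<omega> 3)))"
    by (simp add: configs_sched[OF assms])
  have "at_round (\<lambda>c. LR c 1) 1 (exec sched \<omega>) = Some (LR (fst (exec sched \<omega> 2)) 1)"
  proof (rule at_round_eqI)
    show "entries (run_of (exec sched \<omega>) (Suc 2)) = 1"
      by (subst run) (simp_all add: entries_def losing_run_def)
    fix s :: nat assume s: "s \<le> 2"
    then have "s \<in> {0, 1, 2}" by auto
    then show "entries (run_of (exec sched \<omega>) s) < 1"
      using s by (subst run) (auto simp: entries_def losing_run_def)
  qed
  then show "at_round (\<lambda>c. LR c 1) 1 (exec sched \<omega>) = Some (Some (snd (\<omega> 0)))"
    by (simp only: configs_sched[OF assms])
qed

section \<open>Comparing the lottery events\<close>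

lemma measure_pair_pmf_mono_sections:
  assumes "\<And>p. measure_pmf.prob Q (Pair p -` S) \<le> measure_pmf.prob Q (Pair p -` T)"
  shows "measure_pmf.prob (pair_pmf P Q) S \<le> measure_pmf.prob (pair_pmf P Q) T"
proof -
  have pair: "pair_pmf P Q = bind_pmf P (\<lambda>p. map_pmf (Pair p) Q)"
    by (simp add: pair_pmf_def map_pmf_def)
  have "emeasure (pair_pmf P Q) S \<le> emeasure (pair_pmf P Q) T"
    using assms unfolding pair emeasure_bind_pmf emeasure_map_pmf
    by (intro nn_integral_mono) (simp add: measure_pmf.emeasure_eq_measure)
  then show ?thesis
    by (simp add: measure_pmf.emeasure_eq_measure)
qed

text \<open>The left event belongs to \<open>r' \<noteq> r\<close>, the right one to
  \<open>r' = r\<close>. With \<open>y\<close> and \<open>z\<close> in the first component, a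
  section of the left event is a rectangle in \<open>x\<close> and \<open>w\<close>, so its
  probability factors.\<close>

lemma prob_lose_less:
  fixes L :: "nat pmf"
  assumes "{1, 2, 3} \<subseteq> set_pmf L"
  defines "M \<equiv> pair_pmf (pair_pmf L L) (pair_pmf L L)"
  shows "measure_pmf.prob M {((y, z), (x, w)). x \<le> y \<and> w < z}
     < measure_pmf.prob M {((y, z), (x, w)). x \<le> y \<and> (x < z \<or> z < x \<and> w < z)}"
proof -
  let ?G = "{((y, z), (x, w)). x \<le> y \<and> w < z} :: ((nat \<times> nat) \<times> nat \<times> nat) set"
  let ?H1 = "{((y, z), (x, w)). x \<le> y \<and> x < z} :: ((nat \<times> nat) \<times> nat \<times> nat) set"
  let ?H2 = "{((y, z), (x, w)). x \<le> y \<and> z < x \<and> w < z} :: ((nat \<times> nat) \<times> nat \<times> nat) set"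
  have "measure_pmf.prob M ?G \<le> measure_pmf.prob M ?H1"
    unfolding M_def
  proof (rule measure_pair_pmf_mono_sections)
    fix p :: "nat \<times> nat"
    obtain y z where p: "p = (y, z)" by fastforce
    let ?P = "measure_pmf.prob L"
    have G: "Pair p -` ?G = {..y} \<times> {..<z}" and H: "Pair p -` ?H1 = ({..y} \<inter> {..<z}) \<times> UNIV"
      by (auto simp: p)
    \<comment> \<open>The two initial segments are nested, so the intersection is one of them, and
      the other factor is at most 1.\<close>
    have "?P {..y} * ?P {..<z} \<le> ?P ({..y} \<inter> {..<z})"
    proof (cases "y < z")
      case True
      then have "{..y} \<inter> {..<z} = {..y}" by auto
      then show ?thesis by (simp add: mult_left_le)
    next
      case False
      then have "{..y} \<inter> {..<z} = {..<z}" by auto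
      then show ?thesis by (simp add: mult_left_le_one_le)
    qed
    then show "measure_pmf.prob (pair_pmf L L) (Pair p -` ?G)
        \<le> measure_pmf.prob (pair_pmf L L) (Pair p -` ?H1)"
      unfolding G H by (subst (1 2) measure_pmf_prob_product) auto
  qed
  \<comment> \<open>The chain \<open>w < z < x\<close> needs three distinct lottery values; the
    witness takes 1, 2, 3 and \<open>y = x\<close>. The positivity only prepares the strict
    inequality that is the next link of the calculation.\<close>
  also have "0 < measure_pmf.prob M ?H2"
    by (rule measure_pmf_posI[of "((3, 2), (3, 1))"]) (use assms in auto)
  then have "measure_pmf.prob M ?H1 < measure_pmf.prob M ?H1 + measure_pmf.prob M ?H2"
    by simp
  also have "\<dots> = measure_pmf.prob M (?H1 \<union> ?H2)"
    by (rule measure_pmf.finite_measure_Union[symmetric]) auto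
  also have "?H1 \<union> ?H2 = {((y, z), (x, w)). x \<le> y \<and> (x < z \<or> z < x \<and> w < z)}"
    by auto
  finally show ?thesis .
qed

text \<open>The summand 4 in \<open>lot_max\<close> keeps these values below the top one for every
  \<open>n\<close>.\<close>

lemma set_pmf_lottery: "{1, 2, 3} \<subseteq> set_pmf (lottery (lot_max n))"
proof -
  have b: "4 \<le> lot_max n"
    by (simp add: lot_max_def)
  have "pmf (lottery (lot_max n)) l \<noteq> 0" if "l \<in> {1, 2, 3}" for l
    using that b by (subst pmf_lottery) (auto simp: lottery_mass_def)
  then show ?thesis
    by (auto simp: set_pmf_eq)
qed

section \<open>Reduction to six independent draws\<close>

definition relevant_draws :: "(nat \<Rightarrow> nat \<times> nat) \<Rightarrow> (nat \<times> nat) \<times> (nat \<times> nat) \<times> (nat \<times> nat)"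
  where "relevant_draws \<omega> =
    ((snd (\<omega> 0), snd (\<omega> 3)), (fst (\<omega> 2), fst (\<omega> 6)), (fst (\<omega> 1), fst (\<omega> 7)))"

text \<open>The six values come from six different indices of the product space, hence are
  independent. The nesting separates the \<open>R\<close> values from the lottery values, so that
  the events of interest become products.\<close>

lemma
  fixes n :: nat
  defines "L \<equiv> lottery (lot_max n)" and "U \<equiv> pmf_of_set {0..99::nat}"
  shows measurable_relevant_draws: "relevant_draws \<in> measurable (draws n) (count_space UNIV)"
    and distr_relevant_draws: "distr (draws n) (count_space UNIV) relevant_draws
      = measure_pmf (pair_pmf (pair_pmf U U) (pair_pmf (pair_pmf L L) (pair_pmf L L)))"
proof -
  define J where "J = {0, 1, 2, 3, 6, 7 :: nat}"
  define box :: "(nat \<times> nat) \<times> (nat \<times> nat) \<times> (nat \<times> nat) \<Rightarrow> nat \<Rightarrow> (nat \<times> nat) set" where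
    "box = (\<lambda>((r, r'), (y, z), (x, w)). (\<lambda>_. UNIV)(0 := UNIV \<times> {r}, 1 := {x} \<times> UNIV,
       2 := {y} \<times> UNIV, 3 := UNIV \<times> {r'}, 6 := {z} \<times> UNIV, 7 := {w} \<times> UNIV))"
  let ?M = "\<lambda>_::nat. measure_pmf (pair_pmf L U)"
  have draws: "draws n = PiM UNIV ?M"
    by (simp add: draws_def L_def U_def)
  \<comment> \<open>The fibre over a point is a cylinder over \<open>J\<close>. As the target is
    countable, fibres decide both measurability and the distribution.\<close>
  have vim: "relevant_draws -` {a} = prod_emb UNIV ?M J (Pi\<^sub>E J (box a))" for a
    by (cases a) (auto simp: relevant_draws_def J_def box_def prod_emb_def PiE_iff
        mem_Times_iff)
  have "relevant_draws -` {a} \<in> sets (draws n)" for a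
    unfolding vim draws by (rule sets_PiM_I) (auto simp: J_def)
  then show meas: "relevant_draws \<in> measurable (draws n) (count_space UNIV)"
    by (auto simp: measurable_count_space_eq2_countable draws space_PiM)
  show "distr (draws n) (count_space UNIV) relevant_draws
      = measure_pmf (pair_pmf (pair_pmf U U) (pair_pmf (pair_pmf L L) (pair_pmf L L)))"
  proof (rule measure_eqI_countable[where A = UNIV])
    fix a :: "(nat \<times> nat) \<times> (nat \<times> nat) \<times> (nat \<times> nat)"
    obtain r r' y z x w where a: "a = ((r, r'), (y, z), (x, w))"
      by (metis surj_pair)
    have fst_box: "emeasure (pair_pmf L U) ({l} \<times> UNIV) = pmf L l" for l
      by (simp add: measure_pmf.emeasure_eq_measure measure_pmf_prob_product pmf.rep_eq)
    have snd_box: "emeasure (pair_pmf L U) (UNIV \<times> {l}) = pmf U l" for l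
      by (simp add: measure_pmf.emeasure_eq_measure measure_pmf_prob_product pmf.rep_eq)
    have "emeasure (distr (draws n) (count_space UNIV) relevant_draws) {a}
        = emeasure (draws n) (relevant_draws -` {a})"
      using meas by (simp add: emeasure_distr draws space_PiM)
    also have "\<dots> = (\<Prod>i\<in>J. emeasure (pair_pmf L U) (box a i))"
      unfolding vim draws
      by (rule emeasure_PiM_emb) (auto simp: J_def prob_space_measure_pmf)
    also have "\<dots> = emeasure (pair_pmf (pair_pmf U U) (pair_pmf (pair_pmf L L) (pair_pmf L L))) {a}"
      by (simp add: J_def box_def a fst_box snd_box emeasure_pmf_single pmf_pair
          ennreal_mult' mult_ac)
    finally show "emeasure (distr (draws n) (count_space UNIV) relevant_draws) {a}
      = emeasure (pair_pmf (pair_pmf U U) (pair_pmf (pair_pmf L L) (pair_pmf L L))) {a}" .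
  qed auto
qed

section \<open>Uniform values for the \<open>R\<close> field and the conditional probability\<close>

lemma pair_pmf_of_set:
  assumes "finite A" "A \<noteq> {}" "finite B" "B \<noteq> {}"
  shows "pair_pmf (pmf_of_set A) (pmf_of_set B) = pmf_of_set (A \<times> B)"
proof (rule pmf_eqI)
  fix p :: "'a \<times> 'b"
  show "pmf (pair_pmf (pmf_of_set A) (pmf_of_set B)) p = pmf (pmf_of_set (A \<times> B)) p"
    using assms
    by (cases p) (simp add: pmf_pair pmf_of_set[of A] pmf_of_set[of B] pmf_of_set[of "A \<times> B"]
        card_cartesian_product indicator_def)
qed

lemma prob_uniform_coincidence:
  assumes "finite A" "A \<noteq> {}"
  shows "measure_pmf.prob (pair_pmf (pmf_of_set A) (pmf_of_set A)) {(r, r'). r = r'} = 1 / card A"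
proof -
  have "A \<times> A \<inter> {(r, r'). r = r'} = (\<lambda>r. (r, r)) ` A"
    by auto
  then have "card (A \<times> A \<inter> {(r, r'). r = r'}) = card A"
    by (simp add: card_image inj_on_def)
  then show ?thesis
    using assms by (simp add: pair_pmf_of_set measure_pmf_of_set card_cartesian_product)
qed

lemma prob_exec_eq:
  assumes "{e. \<Phi> e} \<in> sets exec_space"
    and "\<And>\<omega>. \<Phi> (exec A \<omega>) \<longleftrightarrow> relevant_draws \<omega> \<in> S"
  shows "\<P>(e in exec_measure n A. \<Phi> e)
    = measure (distr (draws n) (count_space UNIV) relevant_draws) S"
proof -
  have UN: "space exec_space = UNIV" "space (draws n) = UNIV"
    by (simp_all add: exec_space_def draws_def space_PiM)
  have "\<P>(e in exec_measure n A. \<Phi> e) = measure (draws n) (exec A -` {e. \<Phi> e})"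
    using assms(1) by (simp add: exec_measure_def measure_distr measurable_exec UN)
  also have "exec A -` {e. \<Phi> e} = relevant_draws -` S"
    by (rule set_eqI) (simp only: vimage_eq mem_Collect_eq assms(2))
  finally show ?thesis
    by (simp add: measure_distr[OF measurable_relevant_draws] UN)
qed

text \<open>The positivity clause excludes a conditional probability that is 0 merely through
  division by 0, and \<open>2 \<le> k\<close> makes \<open>k - 1\<close> a genuine round.\<close>

theorem theorem3p7:
  fixes n :: nat
  assumes "2 \<le> n"
  shows "\<exists>(A :: adversary) (k :: nat) (t :: nat) (\<rho> :: run).
    adversary n A \<and> 2 \<le> k \<and> length \<rho> = t \<and> compatible A \<rho> \<and> under_way k \<rho> \<and>
    0 < \<P>(e in exec_measure n A. run_of e t = \<rho>) \<and>
    \<P>(e in exec_measure n A.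
        at_round (\<lambda>c. Some (VR c)) k e \<noteq> at_round (\<lambda>c. LR c 1) (k - 1) e \<bar> run_of e t = \<rho>) < 0.99"
proof -
  define L where "L = lottery (lot_max n)"
  define U where "U = pmf_of_set {0..99::nat}"
  define M where "M = pair_pmf (pair_pmf L L) (pair_pmf L L)"
  define N where "N = pair_pmf (pair_pmf U U) M"
  define G :: "((nat \<times> nat) \<times> nat \<times> nat) set" where
    "G = {((y, z), (x, w)). x \<le> y \<and> w < z}"
  define H :: "((nat \<times> nat) \<times> nat \<times> nat) set" where
    "H = {((y, z), (x, w)). x \<le> y \<and> (x < z \<or> z < x \<and> w < z)}"
  define D :: "(nat \<times> nat) set" where "D = {(r, r'). r = r'}"
  let ?P = "\<lambda>e. at_round (\<lambda>c. Some (VR c)) 2 e \<noteq> at_round (\<lambda>c. LR c 1) (2 - 1) e"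
  let ?Q = "\<lambda>e. run_of e 8 = losing_run"
  define g where "g = measure_pmf.prob M G"
  define h where "h = measure_pmf.prob M H"

  have distr: "distr (draws n) (count_space UNIV) relevant_draws = measure_pmf N"
    unfolding N_def M_def L_def U_def by (rule distr_relevant_draws)
  have Q_iff: "?Q (exec sched \<omega>) \<longleftrightarrow> relevant_draws \<omega> \<in> (- D) \<times> G \<union> D \<times> H" for \<omega>
    unfolding run_sched_iff by (auto simp: relevant_draws_def D_def G_def H_def)
  have PQ_iff: "?P (exec sched \<omega>) \<and> ?Q (exec sched \<omega>) \<longleftrightarrow> relevant_draws \<omega> \<in> (- D) \<times> G" for \<omega>
  proof (cases "?Q (exec sched \<omega>)")
    case True
    then have "?P (exec sched \<omega>) \<longleftrightarrow> snd (\<omega> 0) \<noteq> snd (\<omega> 3)"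
      using at_round_sched[OF True] by auto
    then show ?thesis
      using True Q_iff[of \<omega>] by (auto simp: relevant_draws_def D_def)
  \<comment> \<open>Off the conditioning event both sides are false, as
    \<open>(- D) \<times> G\<close> is part of the set in \<open>Q_iff\<close>.\<close>
  qed (use Q_iff[of \<omega>] in auto)

  have "(\<lambda>e. e 8) \<in> measurable exec_space (count_space UNIV)"
    unfolding exec_space_def by (rule measurable_component_singleton) simp
  then have Q_sets: "{e. ?Q e} \<in> sets exec_space"
    by (rule measurable_sets[of _ _ _ "{p. snd p = losing_run}", THEN back_subst[of "\<lambda>S. S \<in> _"]])
      (auto simp: exec_space_def space_PiM)
  have "Measurable.pred exec_space ?P"
    \<comment> \<open>The compared values lie in a countable type, so one side may be fixed at a
      time.\<close>
    by (rule measurable_compose_countable[OF _ measurable_at_round])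
      (rule measurable_compose[OF measurable_at_round], simp)
  then have P_sets: "{e. ?P e} \<in> sets exec_space"
    by (simp add: pred_def exec_space_def space_PiM)
  have PQ_sets: "{e. ?P e \<and> ?Q e} \<in> sets exec_space"
    using sets.Int[OF P_sets Q_sets] by (simp add: Collect_conj_eq)

  have D: "measure_pmf.prob (pair_pmf U U) D = 1 / 100"
    unfolding D_def U_def by (subst prob_uniform_coincidence) simp_all
  then have D': "measure_pmf.prob (pair_pmf U U) (- D) = 99 / 100"
    using measure_pmf.prob_compl[of D "pair_pmf U U"] by (simp add: Compl_eq_Diff_UNIV)
  have PQ: "\<P>(e in exec_measure n sched. ?P e \<and> ?Q e) = 99 / 100 * g"
    unfolding prob_exec_eq[OF PQ_sets PQ_iff] distr N_def g_def
    by (subst measure_pmf_prob_product) (auto simp: D')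
  have "\<P>(e in exec_measure n sched. ?Q e)
      = measure_pmf.prob N ((- D) \<times> G) + measure_pmf.prob N (D \<times> H)"
    unfolding prob_exec_eq[OF Q_sets Q_iff] distr
    by (rule measure_pmf.finite_measure_Union) auto
  also have "\<dots> = 99 / 100 * g + h / 100"
    unfolding N_def g_def h_def by (subst (1 2) measure_pmf_prob_product) (auto simp: D D')
  finally have Q: "\<P>(e in exec_measure n sched. ?Q e) = 99 / 100 * g + h / 100" .

  \<comment> \<open>For \<open>g = h > 0\<close> the quotient would be exactly 0.99; the strict
    inequality pushes it below. It also gives \<open>h > 0\<close>, so the denominator is positive
    even for \<open>g = 0\<close>.\<close>
  have "g < h"
    unfolding g_def h_def M_def G_def H_def L_def by (rule prob_lose_less[OF set_pmf_lottery])
  moreover have "0 \<le> g"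
    by (simp add: g_def)
  ultimately have pos: "0 < 99 / 100 * g + h / 100"
    and less: "99 / 100 * g / (99 / 100 * g + h / 100) < 0.99"
    by (auto simp: field_simps)
  have "\<P>(e in exec_measure n sched. ?P e \<bar> ?Q e) < 0.99"
    unfolding cond_prob_def PQ Q by (rule less)
  moreover have "adversary n sched"
    using assms by (auto simp: adversary_def sched_def)
  moreover have "length losing_run = 8" "under_way 2 losing_run"
    by (simp_all add: losing_run_def under_way_def entries_def)
  moreover have "0 < \<P>(e in exec_measure n sched. ?Q e)"
    unfolding Q by (rule pos)
  ultimately show ?thesis
    using compatible_losing_run
    by (intro exI[of _ sched] exI[of _ 2] exI[of _ 8] exI[of _ losing_run]) simp
qed

end
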